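(* Over the space $\mathcal{S}$ of star-shaped regions centered at the origin, for any Mulholland function $\alpha$, the topology generated by the symmetric-difference metric $V$ is not finer than the topology generated by the Wasserstein metric $W^\alpha$.
   Context: Fix $n\ge 2$; $\mathbb{E}^n$ is $n$-dimensional Euclidean space with distance $d$ and a chosen origin; $v$ is $n$-dimensional volume. A region is a nonempty bounded open subset of $\mathbb{E}^n$ equal to the interior of its closure. $\mathcal{S}$ is the set of all regions that are star-shaped with respect to the origin. "Finer" is meant in the non-strict sense (finer than or equal to); "not finer" is its negation. The symmetric-difference metric is $V(P,Q)=v((P\setminus Q)\cup(Q\setminus P))$. Mulholland function: a continuous, (strictly) increasing $\psi:\mathbb{R}^{\ge0}\to\mathbb{R}^{\ge0}$ with $\psi(0)=0$, $\lim_{x\to\infty}\psi(x)=\infty$, and $\psi^{-1}(\sum_{i=1}^m\psi(x_i+y_i))\le\psi^{-1}(\sum_{i=1}^m\psi(x_i))+\psi^{-1}(\sum_{i=1}^m\psi(y_i))$ for all $m$ and all $x_i,y_i\ge0$. Wasserstein metric: for a region $P$ let $U_P$ be the uniform probability distribution on $P$. For regions $P,Q$, $W^\psi(P,Q)=\inf_\gamma\psi^{-1}\left(\frac{1}{v(P)}\int_P\psi(d(x,\gamma(x)))\,dx\right)$, the infimum over all (measurable) functions $\gamma$ such that if a random variable $X$ has distribution $U_P$ then $\gamma(X)$ has distribution $U_Q$. *)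

theory Defs
  imports "HOL-Analysis.Analysis"
begin

definition region :: "'a::euclidean_space set \<Rightarrow> bool" where
  "region P \<longleftrightarrow> P \<noteq> {} \<and> bounded P \<and> open P \<and> P = interior (closure P)"

definition star_shaped_at :: "'a::euclidean_space \<Rightarrow> 'a set \<Rightarrow> bool" where
  "star_shaped_at a P \<longleftrightarrow> a \<in> P \<and> (\<forall>x\<in>P. closed_segment a x \<subseteq> P)"

definition star_regions :: "'a::euclidean_space set set" where
  "star_regions = {P. region P \<and> star_shaped_at 0 P}"

definition symdiff_dist :: "'a::euclidean_space set \<Rightarrow> 'a set \<Rightarrow> real" where
  "symdiff_dist P Q = measure lborel ((P - Q) \<union> (Q - P))"

text \<open>
  A function on the nonnegative reals is represented by a function on all reals of which only
  the restriction to \<open>{0..}\<close> matters. Under the other conditions \<open>\<psi>\<close> is a bijection of \<open>{0..}\<close>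
  onto itself, so that \<open>inv_into {0..} \<psi>\<close> is its inverse there.
\<close>

definition mulholland :: "(real \<Rightarrow> real) \<Rightarrow> bool" where
  "mulholland \<psi> \<longleftrightarrow>
     \<psi> \<in> {0..} \<rightarrow> {0..} \<and>
     continuous_on {0..} \<psi> \<and>
     strict_mono_on {0..} \<psi> \<and>
     \<psi> 0 = 0 \<and>
     filterlim \<psi> at_top at_top \<and>
     (\<forall>(m::nat) (x::nat \<Rightarrow> real) (y::nat \<Rightarrow> real).
        (\<forall>i\<in>{1..m}. 0 \<le> x i \<and> 0 \<le> y i) \<longrightarrow>
        inv_into {0..} \<psi> (\<Sum>i=1..m. \<psi> (x i + y i))
          \<le> inv_into {0..} \<psi> (\<Sum>i=1..m. \<psi> (x i)) + inv_into {0..} \<psi> (\<Sum>i=1..m. \<psi> (y i)))"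

text \<open>
  The uniform distribution on \<open>P\<close> is regarded as a measure on the whole space, so a transport map
  is a total Borel function whose values off \<open>P\<close> are irrelevant.
\<close>

definition transport_maps :: "'a::euclidean_space set \<Rightarrow> 'a set \<Rightarrow> ('a \<Rightarrow> 'a) set" where
  "transport_maps P Q =
     {\<gamma>. \<gamma> \<in> measurable (uniform_measure lborel P) lborel \<and>
         distr (uniform_measure lborel P) lborel \<gamma> = uniform_measure lborel Q}"

text \<open>
  For regions \<open>P\<close> and \<open>Q\<close> the integrand below is measurable and almost everywhere bounded, since a
  transport map takes almost all of \<open>P\<close> into the bounded set \<open>Q\<close>; hence it is integrable. The infimum is over a
  nonempty set, since the uniform distribution on \<open>P\<close> is atomless.
\<close>

definition wasserstein :: "(real \<Rightarrow> real) \<Rightarrow> 'a::euclidean_space set \<Rightarrow> 'a set \<Rightarrow> real" where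
  "wasserstein \<psi> P Q =
     (INF \<gamma> \<in> transport_maps P Q.
        inv_into {0..} \<psi> (1 / measure lborel P * (LINT x:P|lborel. \<psi> (dist x (\<gamma> x)))))"

definition metric_topology :: "'b set \<Rightarrow> ('b \<Rightarrow> 'b \<Rightarrow> real) \<Rightarrow> 'b topology" where
  "metric_topology M d = topology_generated_by {{y \<in> M. d x y < r} | x r. x \<in> M \<and> 0 < r}"

text \<open>
  The library's \<open>Metric_space.mtopology\<close> has a usable definition only once its argument has been
  shown to be a metric, in which case the two topologies coincide.
\<close>

lemma metric_topology_eq_mtopology:
  assumes "Metric_space M d"
  shows "metric_topology M d = Metric_space.mtopology M d"
proof -
  interpret Metric_space M d by fact
  have balls: "{{y \<in> M. d x y < r} | x r. x \<in> M \<and> 0 < r} = {mball x r | x r. x \<in> M \<and> 0 < r}"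
    by (auto simp: mball_def)
  show ?thesis
    unfolding metric_topology_def balls
  proof (rule topology_eq[THEN iffD2], intro allI iffI)
    fix U
    assume "openin (topology_generated_by {mball x r | x r. x \<in> M \<and> 0 < r}) U"
    then have "generate_topology_on {mball x r | x r. x \<in> M \<and> 0 < r} U"
      by (rule openin_topology_generated_by)
    then show "openin mtopology U"
      by induction auto
  next
    fix U
    assume U: "openin mtopology U"
    define \<B> where "\<B> = {mball x r | x r. x \<in> M \<and> 0 < r \<and> mball x r \<subseteq> U}"
    have "U = \<Union>\<B>"
    proof
      show "U \<subseteq> \<Union>\<B>"
      proof
        fix x assume "x \<in> U"
        moreover from this U obtain r where "r > 0" "mball x r \<subseteq> U"
          by (auto simp: openin_mtopology)
        moreover have "x \<in> M"
          using U \<open>x \<in> U\<close> by (auto simp: openin_mtopology)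
        ultimately show "x \<in> \<Union>\<B>"
          unfolding \<B>_def by (auto intro!: exI[of _ "mball x r"])
      qed
    qed (auto simp: \<B>_def)
    moreover have "openin (topology_generated_by {mball x r | x r. x \<in> M \<and> 0 < r}) (\<Union>\<B>)"
      by (intro openin_Union) (auto simp: \<B>_def intro!: topology_generated_by_Basis)
    ultimately show "openin (topology_generated_by {mball x r | x r. x \<in> M \<and> 0 < r}) U"
      by simp
  qed
qed

text \<open>Non-strict: every topology is finer than itself.\<close>

definition finer :: "'b topology \<Rightarrow> 'b topology \<Rightarrow> bool" where
  "finer T1 T2 \<longleftrightarrow> (\<forall>U. openin T2 U \<longrightarrow> openin T1 U)"

end

(*
  Join a thin spike of length about 2h to the cube (-1, 1)^n. Moving half of the spike's mass back
  into the cube costs at least \<alpha>(h) times that mass, and \<alpha> is unbounded. As n >= 2, the spike can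
  be given any volume independently of its length, so spikes of volume tending to 0 stay at
  Wasserstein distance at least 1 from the cube.
  The infimum defining the Wasserstein distance has junk value on an empty set, so a transport map
  is needed: cut the cube by a hyperplane and map the two parts affinely onto the cube and the spike.
*)
theory Submission
  imports Defs
begin

section \<open>Balls in generated topologies and the symmetric-difference distance\<close>

text \<open>By induction on how the open set is generated. The only geometric case is a ball about
  another centre \<open>z\<close>, where the triangle inequality admits the radius
  \<open>r - d z x\<close>. Stated from the triangle inequality alone, so that it applies directly
  to \<open>symdiff_dist\<close> on star-shaped regions.\<close>

lemma openin_metric_topology_ball:
  assumes triangle: "\<And>x y z. \<lbrakk>x \<in> M; y \<in> M; z \<in> M\<rbrakk> \<Longrightarrow> d x z \<le> d x y + (d y z :: real)"
    and U: "openin (metric_topology M d) U" "x \<in> U" "x \<in> M"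
  obtains e where "e > 0" "{y \<in> M. d x y < e} \<subseteq> U"
proof -
  have "generate_topology_on {{y \<in> M. d x y < r} | x r. x \<in> M \<and> 0 < r} U"
    using U unfolding metric_topology_def by (intro openin_topology_generated_by)
  then have "x \<in> U \<longrightarrow> (\<exists>e>0. {y \<in> M. d x y < e} \<subseteq> U)"
  proof induction
    case (Int S T)
    show ?case
    proof
      assume "x \<in> S \<inter> T"
      then obtain e1 e2 where "e1 > 0" "{y \<in> M. d x y < e1} \<subseteq> S" "e2 > 0" "{y \<in> M. d x y < e2} \<subseteq> T"
        using Int by auto
      then show "\<exists>e>0. {y \<in> M. d x y < e} \<subseteq> S \<inter> T"
        by (intro exI[of _ "min e1 e2"]) auto
    qed
  next
    case (UN K)
    then show ?case by blast
  next
    case (Basis S)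
    then obtain z r where S: "S = {y \<in> M. d z y < r}" "z \<in> M"
      by auto
    show ?case
    proof
      assume "x \<in> S"
      moreover have "y \<in> S" if "y \<in> M" "d x y < r - d z x" for y
        using triangle[of z x y] that S U(3) by auto
      ultimately show "\<exists>e>0. {y \<in> M. d x y < e} \<subseteq> S"
        using S by (intro exI[of _ "r - d z x"]) auto
    qed
  qed auto
  with U that show ?thesis by blast
qed

lemma region_fmeasurable: "region P \<Longrightarrow> P \<in> fmeasurable lborel"
  unfolding region_def by (metis emeasure_bounded_finite fmeasurableI borel_open sets_lborel)

text \<open>A point separating \<open>P\<close> from \<open>R\<close> separates \<open>P\<close>
  from \<open>Q\<close> or \<open>Q\<close> from \<open>R\<close>. Finite volume matters because
  \<open>measure\<close> takes the value 0 on sets of infinite measure, where monotonicity would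
  fail.\<close>

lemma symdiff_dist_triangle:
  fixes P Q R :: "'a::euclidean_space set"
  assumes "P \<in> fmeasurable lborel" "Q \<in> fmeasurable lborel" "R \<in> fmeasurable lborel"
  shows "symdiff_dist P R \<le> symdiff_dist P Q + symdiff_dist Q R"
proof -
  have sd: "(X - Y) \<union> (Y - X) \<in> fmeasurable lborel"
    if "X \<in> fmeasurable lborel" "Y \<in> fmeasurable lborel" for X Y :: "'a set"
    by (intro fmeasurable.Un fmeasurable.Diff that)
  have "symdiff_dist P R \<le> measure lborel (((P - Q) \<union> (Q - P)) \<union> ((Q - R) \<union> (R - Q)))"
    unfolding symdiff_dist_def
    by (intro measure_mono_fmeasurable fmeasurableD fmeasurable.Un sd assms) auto
  also have "\<dots> \<le> symdiff_dist P Q + symdiff_dist Q R"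
    unfolding symdiff_dist_def by (intro measure_Un_le fmeasurableD sd assms)
  finally show ?thesis .
qed

section \<open>Mulholland functions and their inverses\<close>

lemma mulhollandD:
  assumes "mulholland \<alpha>"
  shows "continuous_on {0..} \<alpha>" "strict_mono_on {0..} \<alpha>" "\<alpha> 0 = 0" "filterlim \<alpha> at_top at_top"
    and "0 \<le> x \<Longrightarrow> 0 \<le> \<alpha> x"
proof -
  have "\<alpha> \<in> {0..} \<rightarrow> {0..}"
    using assms unfolding mulholland_def by blast
  then show "0 \<le> x \<Longrightarrow> 0 \<le> \<alpha> x" by auto
qed (use assms in \<open>simp_all add: mulholland_def\<close>)

text \<open>\<open>inv_into\<close> is meaningful only on the range of \<open>\<alpha>\<close>. That
  range is all of \<open>{0..}\<close> by the intermediate value theorem, since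
  \<open>\<alpha>\<close> starts at 0 and is unbounded.\<close>

lemma mulholland_inv_into:
  assumes "mulholland \<alpha>" "0 \<le> s"
  shows "0 \<le> inv_into {0..} \<alpha> s" "\<alpha> (inv_into {0..} \<alpha> s) = s"
proof -
  have cont: "continuous_on {0..} \<alpha>" and "\<alpha> 0 = 0" and lim: "filterlim \<alpha> at_top at_top"
    using mulhollandD[OF assms(1)] by blast+
  have "eventually (\<lambda>x. s \<le> \<alpha> x \<and> 0 \<le> x) at_top"
    using lim eventually_ge_at_top[of "0::real"] by (auto simp: filterlim_at_top eventually_conj_iff)
  then obtain b where "s \<le> \<alpha> b" "0 \<le> b"
    by (auto dest: eventually_happens)
  then obtain x where "0 \<le> x" "\<alpha> x = s"
    using IVT'[of \<alpha> 0 s b] \<open>\<alpha> 0 = 0\<close> assms(2) continuous_on_subset[OF cont, of "{0..b}"] by auto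
  then have "s \<in> \<alpha> ` {0..}"
    by auto
  then show "0 \<le> inv_into {0..} \<alpha> s" "\<alpha> (inv_into {0..} \<alpha> s) = s"
    using inv_into_into[of s \<alpha> "{0..}"] f_inv_into_f[of s \<alpha> "{0..}"] by auto
qed

lemma mulholland_mono:
  assumes "mulholland \<alpha>" "0 \<le> x" "x \<le> y"
  shows "\<alpha> x \<le> \<alpha> y"
  using strict_mono_onD[OF mulhollandD(2)[OF assms(1)], of x y] assms(2,3) by (cases "x = y") auto

lemma mulholland_le_inv_into:
  assumes "mulholland \<alpha>" "0 \<le> x" "\<alpha> x \<le> s"
  shows "x \<le> inv_into {0..} \<alpha> s"
proof (rule ccontr)
  assume less: "\<not> x \<le> inv_into {0..} \<alpha> s"
  have "0 \<le> s" using mulhollandD(5)[OF assms(1,2)] assms(3) by simp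
  with mulholland_inv_into[OF assms(1) this] less assms(2,3) show False
    using strict_mono_onD[OF mulhollandD(2)[OF assms(1)], of "inv_into {0..} \<alpha> s" x] by auto
qed

section \<open>Bounds for the Wasserstein distance\<close>

lemma wasserstein_self_le:
  assumes \<alpha>: "mulholland \<alpha>"
  shows "wasserstein \<alpha> P P \<le> 0"
proof -
  let ?f = "\<lambda>\<gamma>. inv_into {0..} \<alpha> (1 / measure lborel P * (LINT x:P|lborel. \<alpha> (dist x (\<gamma> x))))"
  \<comment> \<open>A real infimum is known to lie below its members only if the set is bounded
    below, hence this bound for every map.\<close>
  have nonneg: "0 \<le> ?f \<gamma>" for \<gamma>
    by (intro mulholland_inv_into[OF \<alpha>] mult_nonneg_nonneg)
       (auto simp: set_lebesgue_integral_def indicator_def intro!: Bochner_Integration.integral_nonneg mulhollandD(5)[OF \<alpha>])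
  have "distr (uniform_measure lborel P) lborel id = uniform_measure lborel P"
    unfolding id_def by (rule distr_id2) simp
  then have "id \<in> transport_maps P P"
    by (auto simp: transport_maps_def measurable_def)
  then have "wasserstein \<alpha> P P \<le> ?f id"
    unfolding wasserstein_def by (intro cINF_lower bdd_belowI2[where m = 0] nonneg)
  also have "\<alpha> 0 = 0"
    by (rule mulhollandD[OF \<alpha>])
  then have "?f id = inv_into {0..} \<alpha> (\<alpha> 0)"
    by (simp add: set_lebesgue_integral_def)
  also have "\<dots> = 0"
    by (intro inv_into_f_f strict_mono_on_imp_inj_on mulhollandD[OF \<alpha>]) auto
  finally show ?thesis .
qed

text \<open>Every transport map sends a fraction \<open>measure lborel F / measure lborel Q\<close>
  of \<open>P\<close> into \<open>F\<close>, and each point sent there moves at least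
  \<open>h\<close>. So the mean cost is at least \<open>\<alpha> h\<close> times this fraction,
  hence at least \<open>\<alpha> r\<close>.\<close>

lemma le_wasserstein:
  fixes P Q F :: "'a::euclidean_space set"
  assumes \<alpha>: "mulholland \<alpha>"
    and P: "P \<in> sets borel" "bounded P" "measure lborel P \<noteq> 0"
    and Q: "Q \<in> sets borel" "bounded Q" "measure lborel Q \<noteq> 0"
    and F: "F \<in> sets borel" "F \<subseteq> Q" "\<And>x y. x \<in> P \<Longrightarrow> y \<in> F \<Longrightarrow> h \<le> dist x y" "0 \<le> h"
    and r: "0 \<le> r" "\<alpha> r \<le> \<alpha> h * (measure lborel F / measure lborel Q)"
    and nonempty: "transport_maps P Q \<noteq> {}"
  shows "r \<le> wasserstein \<alpha> P Q"
  unfolding wasserstein_def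
proof (rule cINF_greatest[OF nonempty])
  fix \<gamma> assume "\<gamma> \<in> transport_maps P Q"
  then have \<gamma>[measurable]: "\<gamma> \<in> borel_measurable borel"
    and distr: "distr (uniform_measure lborel P) lborel \<gamma> = uniform_measure lborel Q"
    by (auto simp: transport_maps_def measurable_def)
  note [measurable] = P(1) Q(1) F(1)
  have fin: "emeasure lborel P < \<infinity>" "emeasure lborel Q < \<infinity>"
    using P Q emeasure_bounded_finite by auto
  then have pos: "emeasure lborel P \<noteq> 0" "emeasure lborel Q \<noteq> 0"
    using P Q by (auto simp: measure_def)
  have \<gamma>u: "\<gamma> \<in> measurable (uniform_measure lborel P) lborel"
    by (simp add: measurable_def[of borel] measurable_def[of "uniform_measure lborel P"])
       (use \<gamma> in \<open>auto simp: measurable_def\<close>)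
  have vim: "\<gamma> -` F \<in> sets lborel"
    using measurable_sets[OF \<gamma> F(1)] by simp
  have "measure (uniform_measure lborel Q) F = measure (uniform_measure lborel P) (\<gamma> -` F)"
    unfolding distr[symmetric] using \<gamma>u by (subst measure_distr) auto
  then have mass: "measure lborel F / measure lborel Q = measure lborel (P \<inter> \<gamma> -` F) / measure lborel P"
    using fin pos P Q F vim by (simp add: measure_uniform_measure Int_absorb1)
  \<comment> \<open>Almost all of \<open>P\<close> lands in the bounded set \<open>Q\<close>, so the
    cost is essentially bounded and thus integrable. Without integrability the integral would be 0
    by default and the lower bound would be lost.\<close>
  have "AE y in uniform_measure lborel Q. y \<in> Q"
    by (simp add: AE_uniform_measureI)
  then have "AE x in uniform_measure lborel P. \<gamma> x \<in> Q"
    unfolding distr[symmetric] using \<gamma>u by (simp add: AE_distr_iff)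
  then have AE: "AE x in lborel. x \<in> P \<longrightarrow> \<gamma> x \<in> Q"
    using fin pos by (simp add: AE_uniform_measure)
  have "bounded (P \<union> Q)"
    using P Q by simp
  then obtain D where D: "\<And>x y. x \<in> P \<union> Q \<Longrightarrow> y \<in> P \<union> Q \<Longrightarrow> dist x y \<le> D"
    using bounded_two_points by metis
  \<comment> \<open>\<open>\<alpha>\<close> is controlled only on \<open>{0..}\<close>; composing
    with \<open>max 0\<close> gives a function continuous on the whole line that agrees with it at
    all distances.\<close>
  have "continuous_on UNIV (\<lambda>t. \<alpha> (max 0 t))"
    by (intro continuous_on_compose2[OF mulhollandD(1)[OF \<alpha>]] continuous_intros) auto
  then have "(\<lambda>t. \<alpha> (max 0 t)) \<in> borel_measurable borel"
    by (rule borel_measurable_continuous_onI)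
  then have "(\<lambda>x. (\<lambda>t. \<alpha> (max 0 t)) (dist x (\<gamma> x))) \<in> borel_measurable borel"
    by (rule measurable_compose[rotated]) measurable
  then have [measurable]: "(\<lambda>x. \<alpha> (dist x (\<gamma> x))) \<in> borel_measurable borel"
    by (simp add: max_def)
  have int: "set_integrable lborel P (\<lambda>x. \<alpha> (dist x (\<gamma> x)))"
    unfolding set_integrable_def
  proof (rule integrableI_bounded_set[where A = P and B = "\<alpha> D"])
    show "AE x\<in>P in lborel. norm (indicat_real P x *\<^sub>R \<alpha> (dist x (\<gamma> x))) \<le> \<alpha> D"
      using AE
    proof eventually_elim
      case (elim x)
      then show ?case
        using D[of x "\<gamma> x"] mulholland_mono[OF \<alpha>, of "dist x (\<gamma> x)" D]
          mulhollandD(5)[OF \<alpha>, of "dist x (\<gamma> x)"] by auto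
    qed
  qed (use fin in auto)
  have "\<alpha> h * measure lborel (P \<inter> \<gamma> -` F) = (LINT x|lborel. \<alpha> h * indicat_real (P \<inter> \<gamma> -` F) x)"
    by simp
  also have "\<dots> \<le> (LINT x:P|lborel. \<alpha> (dist x (\<gamma> x)))"
    unfolding set_lebesgue_integral_def
  proof (rule integral_mono)
    have "emeasure lborel (P \<inter> \<gamma> -` F) < \<infinity>"
      by (intro le_less_trans[OF emeasure_mono fin(1)]) auto
    then show "integrable lborel (\<lambda>x. \<alpha> h * indicat_real (P \<inter> \<gamma> -` F) x)"
      using vim by (intro integrable_mult_right integrable_real_indicator) auto
    show "\<alpha> h * indicat_real (P \<inter> \<gamma> -` F) x \<le> indicat_real P x *\<^sub>R \<alpha> (dist x (\<gamma> x))" for x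
      using F(3)[of x "\<gamma> x"] mulholland_mono[OF \<alpha> F(4), of "dist x (\<gamma> x)"]
        mulhollandD(5)[OF \<alpha>, of "dist x (\<gamma> x)"] by (auto simp: indicator_def)
  qed (use int in \<open>simp add: set_integrable_def\<close>)
  finally have "\<alpha> h * (measure lborel (P \<inter> \<gamma> -` F) / measure lborel P)
      \<le> 1 / measure lborel P * (LINT x:P|lborel. \<alpha> (dist x (\<gamma> x)))"
    using divide_right_mono[of _ _ "measure lborel P"] by fastforce
  then show "r \<le> inv_into {0..} \<alpha> (1 / measure lborel P * (LINT x:P|lborel. \<alpha> (dist x (\<gamma> x))))"
    using r mass by (intro mulholland_le_inv_into[OF \<alpha>]) auto
qed

section \<open>Star-shaped regions as unions of convex sets\<close>

text \<open>The point is regularity. A point \<open>x\<close> in the interior of the closure can be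
  scaled outward by some \<open>s > 1\<close> and still lie in the closure of \<open>A\<close> or of
  \<open>B\<close>. Scaling back by \<open>1 / s < 1\<close> moves the closure of an open convex set
  containing 0 into the set itself, so \<open>x\<close> lies in the union.\<close>

lemma star_regions_Un_convex:
  fixes A B :: "'a::euclidean_space set"
  assumes A: "convex A" "open A" "bounded A" "0 \<in> A"
    and B: "convex B" "open B" "bounded B" "0 \<in> B"
  shows "A \<union> B \<in> star_regions"
proof -
  have shrink: "t *\<^sub>R y \<in> C" if "convex C" "open C" "0 \<in> C" "y \<in> closure C" "0 \<le> t" "t < 1"
    for C :: "'a set" and t y
    using mem_interior_closure_convex_shrink[of C 0 y "1 - t"] that
    by (cases "t = 0") (auto simp: interior_open algebra_simps)
  have "interior (closure (A \<union> B)) \<subseteq> A \<union> B"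
  proof
    fix x assume "x \<in> interior (closure (A \<union> B))"
    moreover have "((\<lambda>s. s *\<^sub>R x) \<longlongrightarrow> 1 *\<^sub>R x) (at_right 1)"
      by (intro tendsto_intros)
    ultimately have "eventually (\<lambda>s. s *\<^sub>R x \<in> interior (closure (A \<union> B))) (at_right (1::real))"
      by (auto dest: topological_tendstoD)
    then have "eventually (\<lambda>s. s *\<^sub>R x \<in> interior (closure (A \<union> B)) \<and> s > 1) (at_right (1::real))"
      by (simp add: eventually_conj_iff eventually_at_right_less)
    then obtain s :: real where s: "s *\<^sub>R x \<in> interior (closure (A \<union> B))" "s > 1"
      using eventually_happens'[OF trivial_limit_at_right_real] by blast
    then have "s *\<^sub>R x \<in> closure A \<union> closure B"
      using interior_subset by (auto simp: closure_Un)
    then have "(1 / s) *\<^sub>R s *\<^sub>R x \<in> A \<union> B"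
      using shrink[of A "s *\<^sub>R x" "1 / s"] shrink[of B "s *\<^sub>R x" "1 / s"] A B s by auto
    then show "x \<in> A \<union> B" using s by simp
  qed
  moreover have "A \<union> B \<subseteq> interior (closure (A \<union> B))"
    using A B by (intro interior_maximal closure_subset) auto
  ultimately have "region (A \<union> B)"
    using A B unfolding region_def by auto
  moreover have "star_shaped_at 0 (A \<union> B)"
    using A B closed_segment_subset[of 0 A] closed_segment_subset[of 0 B]
    unfolding star_shaped_at_def by (auto dest: subsetD)
  ultimately show ?thesis
    by (simp add: star_regions_def)
qed

section \<open>Affine maps, boxes and a transport map from the cube\<close>

text \<open>\<open>lborel_affine_euclidean\<close> evaluated at one set, phrased with preimages
  because pushforwards are computed from them.\<close>

lemma emeasure_lborel_vimage_affine:
  fixes t :: "'a::euclidean_space" and c :: "'a \<Rightarrow> real"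
  assumes "\<And>j. j \<in> Basis \<Longrightarrow> c j \<noteq> 0" and S: "S \<in> sets borel"
  shows "emeasure lborel S = ennreal (\<Prod>j\<in>Basis. \<bar>c j\<bar>) *
    emeasure lborel ((\<lambda>x. t + (\<Sum>j\<in>Basis. (c j * (x \<bullet> j)) *\<^sub>R j)) -` S)"
proof -
  let ?T = "\<lambda>x. t + (\<Sum>j\<in>Basis. (c j * (x \<bullet> j)) *\<^sub>R j)"
  have "emeasure lborel S = emeasure (density (distr lborel borel ?T) (\<lambda>_. ennreal (\<Prod>j\<in>Basis. \<bar>c j\<bar>))) S"
    using lborel_affine_euclidean[of c t] assms by simp
  also have "\<dots> = ennreal (\<Prod>j\<in>Basis. \<bar>c j\<bar>) * emeasure lborel (?T -` S)"
    using S by (subst emeasure_density_const) (auto simp: emeasure_distr)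
  finally show ?thesis .
qed

text \<open>One family of boxes serves as the cube \<open>beam e (-1) 1 1\<close>, the spike
  \<open>beam e (-1) L \<delta>\<close> and the far half of the spike. The spike starts at -1 so
  that it is itself a convex set containing the origin.\<close>

definition beam :: "'a::euclidean_space \<Rightarrow> real \<Rightarrow> real \<Rightarrow> real \<Rightarrow> 'a set" where
  "beam e a b \<delta> = box (\<Sum>i\<in>Basis. (if i = e then a else - \<delta>) *\<^sub>R i)
                      (\<Sum>i\<in>Basis. (if i = e then b else \<delta>) *\<^sub>R i)"

lemma mem_beam:
  assumes "e \<in> Basis"
  shows "x \<in> beam e a b \<delta> \<longleftrightarrow> a < x \<bullet> e \<and> x \<bullet> e < b \<and> (\<forall>i\<in>Basis - {e}. \<bar>x \<bullet> i\<bar> < \<delta>)"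
proof -
  have "(\<forall>i\<in>Basis - {e}. \<bar>x \<bullet> i\<bar> < \<delta>) \<longleftrightarrow> (\<forall>i\<in>Basis - {e}. - \<delta> < x \<bullet> i \<and> x \<bullet> i < \<delta>)"
    by (intro ball_cong refl) linarith
  then show ?thesis
    using assms unfolding beam_def mem_box by (auto split: if_splits)
qed

lemma open_beam: "open (beam e a b \<delta>)"
  and convex_beam: "convex (beam e a b \<delta>)"
  and bounded_beam: "bounded (beam e a b \<delta>)"
  by (simp_all add: beam_def open_box bounded_box)

lemma measure_beam:
  fixes e :: "'a::euclidean_space"
  assumes "e \<in> Basis" "a \<le> b" "0 \<le> \<delta>"
  shows "measure lborel (beam e a b \<delta>) = (b - a) * (2 * \<delta>) ^ (DIM('a) - 1)"
proof -
  have "measure lborel (beam e a b \<delta>) = (\<Prod>i\<in>Basis. if i = e then b - a else 2 * \<delta>)"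
    unfolding beam_def using assms
    by (subst measure_lborel_box) (auto simp: inner_diff_left intro!: prod.cong)
  also have "\<dots> = (b - a) * (\<Prod>i\<in>Basis - {e}. 2 * \<delta>)"
    using assms by (subst prod.remove[of _ e]) (auto intro!: prod.cong)
  finally show ?thesis using assms by simp
qed

text \<open>Two affine pieces with the same determinant \<open>k\<close> map disjoint parts of the
  cube onto the cube and onto the protruding spike. All volumes then scale by the same factor, so
  the uniform distribution goes to the uniform distribution.\<close>

lemma transport_maps_beam_nonempty:
  fixes e :: "'a::euclidean_space"
  assumes e: "e \<in> Basis" and L: "1 < L" and \<delta>: "0 < \<delta>" "\<delta> \<le> 1"
  shows "transport_maps (beam e (-1) 1 1) (beam e (-1) 1 1 \<union> beam e (-1) L \<delta>) \<noteq> {}"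
proof -
  let ?A = "beam e (-1) 1 1" and ?B = "beam e (-1) L \<delta>"
  \<comment> \<open>\<open>p / 2\<close> is the volume of the protruding part of the spike relative
    to the cube, so \<open>k\<close> below is the volume of the union relative to the cube.\<close>
  define p where "p = (L - 1) * \<delta> ^ (DIM('a) - 1)"
  have p: "0 < p" using L \<delta> by (simp add: p_def)
  \<comment> \<open>The cut \<open>c\<close> divides the cube in the ratio of the volumes of the cube and of the part of the
    spike outside it, so that the affine maps of the two parts have the same determinant \<open>k\<close>.\<close>
  define k where "k = 1 + p / 2"
  define c where "c = 2 / k - 1"
  have k: "1 < k" using p by (simp add: k_def)
  have c: "1 + c = 2 / k" "1 - c = p / k"
    using k p by (auto simp: c_def k_def field_simps)
  then have c_bounds: "-1 < c" "c < 1"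
    using k p by (smt (verit) divide_pos_pos)+
  define T where "T s u w x = u *\<^sub>R e + (\<Sum>j\<in>Basis. ((if j = e then s else w) * (x \<bullet> j)) *\<^sub>R j)"
    for s u w :: real and x :: 'a
  have T_inner: "T s u w x \<bullet> i = (if i = e then u + s * (x \<bullet> e) else w * (x \<bullet> i))"
    if "i \<in> Basis" for s u w x i
    using e that by (auto simp: T_def inner_add_left inner_Basis)
  have T_measurable[measurable]: "T s u w \<in> borel_measurable borel" for s u w
    unfolding T_def by measurable
  have T_measure: "emeasure lborel S = ennreal (s * w ^ (DIM('a) - 1)) * emeasure lborel (T s u w -` S)"
    if "0 < s" "0 < w" "S \<in> sets borel" for s u w S
  proof -
    have "(\<Prod>j\<in>Basis. \<bar>if j = e then s else w\<bar>) = s * (\<Prod>j\<in>Basis - {e}. w)"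
      using e that by (subst prod.remove[of _ e]) (auto intro!: prod.cong)
    then show ?thesis
      using emeasure_lborel_vimage_affine[of "\<lambda>j. if j = e then s else w" S "u *\<^sub>R e"] that e
      unfolding T_def by auto
  qed
  \<comment> \<open>Along \<open>e\<close>, \<open>T1\<close> takes the interval from -1 to
    \<open>c\<close> to that from -1 to 1, and \<open>T2\<close> takes that from \<open>c\<close> to
    1 to that from 1 to \<open>L\<close>. The factor in \<open>T2\<close> is
    \<open>(L - 1) / (1 - c)\<close>.\<close>
  define T1 where "T1 = T k (k - 1) 1"
  define T2 where "T2 = T (k * (L - 1) / p) (1 - c * (k * (L - 1) / p)) \<delta>"
  define \<gamma> where "\<gamma> x = (if x \<bullet> e < c then T1 x else T2 x)" for x
  have [measurable]: "\<gamma> \<in> borel_measurable borel"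
    unfolding \<gamma>_def T1_def T2_def by measurable
  have [measurable]: "?A \<in> sets borel" "?B \<in> sets borel"
    by (simp_all add: borel_open open_beam)
  have T1_iff: "T1 x \<in> ?A \<longleftrightarrow> x \<in> ?A \<and> x \<bullet> e < c" for x
  proof -
    have "-1 < k - 1 + k * (x \<bullet> e) \<longleftrightarrow> 0 < k * (x \<bullet> e + 1)"
      by (simp add: algebra_simps)
    then have 1: "-1 < k - 1 + k * (x \<bullet> e) \<longleftrightarrow> -1 < x \<bullet> e"
      using k by (auto simp: zero_less_mult_iff)
    have 2: "k - 1 + k * (x \<bullet> e) < 1 \<longleftrightarrow> x \<bullet> e < c"
      using k by (simp add: c_def field_simps)
    show ?thesis
      using 1 2 e c_bounds by (auto simp: mem_beam T1_def T_inner)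
  qed
  \<comment> \<open>The cutting hyperplane belongs to the second part, and its image at height 1
    belongs to \<open>?B - ?A\<close>. The equivalences are therefore exact, with no null sets to
    discard.\<close>
  have T2_iff: "T2 x \<in> ?B - ?A \<longleftrightarrow> x \<in> ?A \<and> \<not> x \<bullet> e < c" for x
  proof -
    define s where "s = k * (L - 1) / p"
    have s: "0 < s" using k L p by (simp add: s_def)
    have end_eq: "s * (1 - c) = L - 1" using k p c by (simp add: s_def)
    have "1 \<le> 1 - c * s + s * (x \<bullet> e) \<longleftrightarrow> 0 \<le> s * (x \<bullet> e - c)"
      by (simp add: algebra_simps)
    then have 1: "1 \<le> 1 - c * s + s * (x \<bullet> e) \<longleftrightarrow> \<not> x \<bullet> e < c"
      using s by (auto simp: zero_le_mult_iff)
    have "1 - c * s + s * (x \<bullet> e) < L \<longleftrightarrow> 0 < s * (1 - x \<bullet> e)"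
      using end_eq by (auto simp: algebra_simps)
    then have 2: "1 - c * s + s * (x \<bullet> e) < L \<longleftrightarrow> x \<bullet> e < 1"
      using s by (simp add: zero_less_mult_iff)
    have 3: "\<bar>\<delta> * (x \<bullet> i)\<bar> < \<delta> \<longleftrightarrow> \<bar>x \<bullet> i\<bar> < 1" for i
      using \<delta> by (simp add: abs_mult)
    have BA: "y \<in> ?B - ?A \<longleftrightarrow> 1 \<le> y \<bullet> e \<and> y \<bullet> e < L \<and> (\<forall>i\<in>Basis - {e}. \<bar>y \<bullet> i\<bar> < \<delta>)" for y
      using e \<delta> by (force simp: mem_beam)
    have "T2 x \<in> ?B - ?A \<longleftrightarrow> 1 \<le> 1 - c * s + s * (x \<bullet> e) \<and> 1 - c * s + s * (x \<bullet> e) < L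
        \<and> (\<forall>i\<in>Basis - {e}. \<bar>\<delta> * (x \<bullet> i)\<bar> < \<delta>)"
      unfolding BA T2_def s_def[symmetric] using e by (auto simp: T_inner)
    also have "\<dots> \<longleftrightarrow> x \<in> ?A \<and> \<not> x \<bullet> e < c"
      unfolding 1 2 3 using e c_bounds by (auto simp: mem_beam)
    finally show ?thesis .
  qed
  \<comment> \<open>For \<open>S = UNIV\<close> this also relates the two normalising
    volumes.\<close>
  have main: "emeasure lborel ((?A \<union> ?B) \<inter> S) = ennreal k * emeasure lborel (?A \<inter> \<gamma> -` S)"
    if [measurable]: "S \<in> sets borel" for S
  proof -
    have "?A \<inter> \<gamma> -` S = T1 -` (?A \<inter> S) \<union> T2 -` ((?B - ?A) \<inter> S)"
    proof (rule set_eqI)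
      show "x \<in> ?A \<inter> \<gamma> -` S \<longleftrightarrow> x \<in> T1 -` (?A \<inter> S) \<union> T2 -` ((?B - ?A) \<inter> S)" for x
        using T1_iff[of x] T2_iff[of x] by (cases "x \<bullet> e < c") (auto simp: \<gamma>_def)
    qed
    moreover have "T1 -` (?A \<inter> S) \<inter> T2 -` ((?B - ?A) \<inter> S) = {}"
      using T1_iff T2_iff by auto
    moreover have "T1 -` (?A \<inter> S) \<in> sets lborel" "T2 -` ((?B - ?A) \<inter> S) \<in> sets lborel"
      using measurable_sets_borel[of "T _ _ _" borel] unfolding T1_def T2_def by simp_all
    ultimately have "emeasure lborel (?A \<inter> \<gamma> -` S) =
        emeasure lborel (T1 -` (?A \<inter> S)) + emeasure lborel (T2 -` ((?B - ?A) \<inter> S))"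
      by (simp add: plus_emeasure)
    moreover have "emeasure lborel (?A \<inter> S) = ennreal k * emeasure lborel (T1 -` (?A \<inter> S))"
      using T_measure[of k 1 "?A \<inter> S" "k - 1"] k unfolding T1_def by simp
    moreover have "emeasure lborel ((?B - ?A) \<inter> S) = ennreal k * emeasure lborel (T2 -` ((?B - ?A) \<inter> S))"
    proof -
      have "k * (L - 1) / p * \<delta> ^ (DIM('a) - 1) = k * p / p"
        by (simp only: p_def times_divide_eq_left mult.assoc)
      then have "k * (L - 1) / p * \<delta> ^ (DIM('a) - 1) = k"
        using p by simp
      moreover have "0 < k * (L - 1) / p" "(?B - ?A) \<inter> S \<in> sets borel"
        using k p L by simp_all
      ultimately show ?thesis
        using T_measure[of "k * (L - 1) / p" \<delta> "(?B - ?A) \<inter> S"] \<delta> unfolding T2_def by metis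
    qed
    moreover have "emeasure lborel ((?A \<union> ?B) \<inter> S) = emeasure lborel (?A \<inter> S) + emeasure lborel ((?B - ?A) \<inter> S)"
      by (subst plus_emeasure) (auto intro!: arg_cong[where f = "emeasure lborel"])
    ultimately show ?thesis
      by (simp add: distrib_left)
  qed
  have "distr (uniform_measure lborel ?A) lborel \<gamma> = uniform_measure lborel (?A \<union> ?B)"
  proof (rule measure_eqI)
    fix S assume "S \<in> sets (distr (uniform_measure lborel ?A) lborel \<gamma>)"
    then have [measurable]: "S \<in> sets borel" by simp
    have "\<gamma> \<in> measurable (uniform_measure lborel ?A) lborel"
      by (simp cong: measurable_cong_sets)
    then have "emeasure (distr (uniform_measure lborel ?A) lborel \<gamma>) S = emeasure lborel (?A \<inter> \<gamma> -` S) / emeasure lborel ?A"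
      using measurable_sets_borel[of \<gamma> borel S] by (simp add: emeasure_distr)
    also have "\<dots> = (ennreal k * emeasure lborel (?A \<inter> \<gamma> -` S)) / (ennreal k * emeasure lborel ?A)"
      using k by (simp add: divide_mult_eq mult.commute[of "ennreal k"])
    also have "\<dots> = emeasure (uniform_measure lborel (?A \<union> ?B)) S"
      using main[of S] main[of UNIV] by simp
    finally show "emeasure (distr (uniform_measure lborel ?A) lborel \<gamma>) S = emeasure (uniform_measure lborel (?A \<union> ?B)) S" .
  qed simp
  moreover have "\<gamma> \<in> measurable (uniform_measure lborel ?A) lborel"
    by (simp cong: measurable_cong_sets)
  ultimately show ?thesis
    unfolding transport_maps_def by blast
qed

section \<open>Thin spikes on the cube separate the two topologies\<close>

theorem theorem20:
  fixes \<alpha> :: "real \<Rightarrow> real"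
  assumes "DIM('a::euclidean_space) \<ge> 2"
    and "mulholland \<alpha>"
  shows "\<not> finer (metric_topology (star_regions :: 'a set set) symdiff_dist)
                 (metric_topology (star_regions :: 'a set set) (wasserstein \<alpha>))"
proof
  assume fin: "finer (metric_topology (star_regions :: 'a set set) symdiff_dist)
                 (metric_topology (star_regions :: 'a set set) (wasserstein \<alpha>))"
  obtain e :: 'a where e: "e \<in> Basis" using nonempty_Basis by blast
  let ?A = "beam e (-1) 1 1" and ?n = "DIM('a) - 1"
  let ?U = "{Q \<in> star_regions. wasserstein \<alpha> ?A Q < 1}"
  have A: "?A \<in> star_regions"
    using star_regions_Un_convex[of ?A ?A] e by (simp add: open_beam convex_beam bounded_beam mem_beam)
  then have "openin (metric_topology star_regions (wasserstein \<alpha>)) ?U"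
    unfolding metric_topology_def by (intro topology_generated_by_Basis) (use zero_less_one in blast)
  then have "openin (metric_topology star_regions symdiff_dist) ?U"
    using fin by (auto simp: finer_def)
  moreover have "?A \<in> ?U"
    using A wasserstein_self_le[OF assms(2), of ?A] by simp
  ultimately obtain \<epsilon> where \<epsilon>: "\<epsilon> > 0" "{Q \<in> star_regions. symdiff_dist ?A Q < \<epsilon>} \<subseteq> ?U"
    using openin_metric_topology_ball[of star_regions symdiff_dist ?U ?A] A
      symdiff_dist_triangle region_fmeasurable unfolding star_regions_def by blast

  \<comment> \<open>\<open>p / 2\<close> is the volume added by the spike relative to that of the cube.\<close>
  define p where "p = min 1 (\<epsilon> / 2 ^ DIM('a))"
  have p: "0 < p" "p \<le> 1" "p * 2 ^ DIM('a) \<le> \<epsilon>"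
    using \<epsilon> by (auto simp: p_def min_def field_simps)
  have "filterlim \<alpha> at_top at_top"
    by (rule mulhollandD[OF assms(2)])
  \<comment> \<open>The far half of the spike will hold the fraction
    \<open>p / (2 * (2 + p))\<close> of the volume, at least \<open>p / 8\<close> since
    \<open>p \<le> 1\<close>. Moving it by \<open>h\<close> then costs at least
    \<open>\<alpha> 1\<close>. The bound \<open>1 \<le> h\<close> ensures
    \<open>\<delta> \<le> 1\<close>.\<close>
  then have "eventually (\<lambda>h. \<alpha> 1 * 8 / p \<le> \<alpha> h \<and> 1 \<le> h) at_top"
    using eventually_ge_at_top[of "1::real"] by (auto simp: filterlim_at_top eventually_conj_iff)
  then obtain h where h: "\<alpha> 1 * 8 / p \<le> \<alpha> h" "1 \<le> h"
    by (auto dest: eventually_happens)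
  define L where "L = 1 + 2 * h"
  \<comment> \<open>Chosen so that the protruding part, of length \<open>2 * h\<close>, has volume
    \<open>p * 2 ^ ?n\<close> whatever \<open>h\<close> is. Here dimension at least 2 enters: the
    root has positive index.\<close>
  define \<delta> where "\<delta> = root ?n (p / (2 * h))"
  have \<delta>n: "\<delta> ^ ?n = p / (2 * h)" and \<delta>: "0 < \<delta>" "\<delta> \<le> 1"
    using assms(1) p h by (auto simp: \<delta>_def)
  \<comment> \<open>\<open>?F\<close> is the outer half of the protruding part, so a gap of
    \<open>h\<close> separates it from the cube.\<close>
  let ?B = "beam e (-1) L \<delta>" and ?F = "beam e (1 + h) L \<delta>"
  let ?Q = "?A \<union> ?B"
  have two: "(2::real) ^ DIM('a) = 2 * 2 ^ ?n"
    using assms(1) by (metis DIM_positive Suc_pred' power_Suc)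
  have Q: "?Q \<in> star_regions"
    using e h \<delta> by (intro star_regions_Un_convex) (auto simp: open_beam convex_beam bounded_beam mem_beam L_def)
  have mA: "measure lborel ?A = 2 * 2 ^ ?n"
    using e by (simp add: measure_beam)
  have mB: "measure lborel ?B = (p / h + p) * 2 ^ ?n"
    using measure_beam[OF e, of "-1" L \<delta>] h \<delta> unfolding power_mult_distrib \<delta>n
    by (simp add: L_def field_simps)
  have mF: "measure lborel ?F = p / 2 * 2 ^ ?n"
    using measure_beam[OF e, of "1 + h" L \<delta>] h \<delta> unfolding power_mult_distrib \<delta>n
    by (simp add: L_def field_simps)
  have "?A \<inter> ?B = beam e (-1) 1 \<delta>"
    using e h \<delta> by (force simp: mem_beam L_def)
  then have mAB: "measure lborel (?A \<inter> ?B) = p / h * 2 ^ ?n"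
    using measure_beam[OF e, of "-1" 1 \<delta>] \<delta> unfolding power_mult_distrib \<delta>n
    by (simp add: field_simps)
  have fm: "?A \<in> fmeasurable lborel" "?B \<in> fmeasurable lborel"
    by (auto intro!: fmeasurableI borel_open open_beam emeasure_bounded_finite bounded_beam)
  have "?B - ?A = ?B - (?A \<inter> ?B)" by auto
  then have "measure lborel (?B - ?A) = measure lborel ?B - measure lborel (?A \<inter> ?B)"
    using measurable_measure_Diff[OF fm(2), of "?A \<inter> ?B"] sets.Int[OF fm[THEN fmeasurableD]] by simp
  then have mBA: "measure lborel (?B - ?A) = p * 2 ^ ?n"
    unfolding mB mAB by (simp add: algebra_simps)
  have mQ: "measure lborel ?Q = (2 + p) * 2 ^ ?n"
    unfolding measure_Un3[OF fm] mA mB mAB by (simp add: algebra_simps)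
  have "symdiff_dist ?A ?Q = measure lborel (?B - ?A)"
    unfolding symdiff_dist_def by (rule arg_cong[where f = "measure lborel"]) auto
  \<comment> \<open>The choice of \<open>p\<close> leaves a factor 2 to spare, which makes the
    inequality strict.\<close>
  have "symdiff_dist ?A ?Q < \<epsilon>"
  proof -
    have "2 * (p * 2 ^ ?n) \<le> \<epsilon>"
      using p(3) unfolding two by (simp only: mult_ac)
    moreover have "0 < p * 2 ^ ?n"
      using p by simp
    ultimately show ?thesis
      using mBA \<open>symdiff_dist ?A ?Q = _\<close> by linarith
  qed
  with \<epsilon> Q have "wasserstein \<alpha> ?A ?Q < 1" by blast
  moreover have "1 \<le> wasserstein \<alpha> ?A ?Q"
  proof (rule le_wasserstein[where F = ?F and h = h])
    show "h \<le> dist x y" if "x \<in> ?A" "y \<in> ?F" for x y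
    proof -
      have "h \<le> (y - x) \<bullet> e"
        using that e by (simp add: mem_beam inner_diff_left)
      also have "\<dots> \<le> dist x y"
        using Basis_le_norm[OF e, of "y - x"] by (simp add: dist_norm norm_minus_commute)
      finally show ?thesis .
    qed
    have "measure lborel ?F / measure lborel ?Q = p / (2 * (2 + p))"
      unfolding mF mQ by simp
    moreover have "p / 8 \<le> p / (2 * (2 + p))"
      using p by (intro divide_left_mono) auto
    moreover have "0 \<le> \<alpha> h"
      using mulhollandD(5)[OF assms(2), of h] h by simp
    ultimately have "\<alpha> h * (p / 8) \<le> \<alpha> h * (measure lborel ?F / measure lborel ?Q)"
      by (intro mult_left_mono) auto
    moreover have "\<alpha> 1 \<le> \<alpha> h * (p / 8)"
      using h(1) p by (simp add: field_simps)
    ultimately show "\<alpha> 1 \<le> \<alpha> h * (measure lborel ?F / measure lborel ?Q)"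
      by (rule order_trans[rotated])
    show "?F \<subseteq> ?Q"
      using e h by (auto simp: mem_beam)
    show "transport_maps ?A ?Q \<noteq> {}"
      using h \<delta> by (intro transport_maps_beam_nonempty[OF e]) (auto simp: L_def)
    show "measure lborel ?Q \<noteq> 0" "measure lborel ?A \<noteq> 0"
      unfolding mQ mA using p by auto
  qed (use assms(2) h in \<open>auto intro!: bounded_beam borel_open open_beam\<close>)
  ultimately show False by simp
qed

end
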